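(* Let $n\in\mathbb N=\{1,2,\dots\}$ and let $q^{(n)}$ be the smallest element of $\mathcal U\cap(n,n+1)$ (which exists). Define a sequence $(c_i)_{i\ge1}$ with values in $\{0,\dots,n\}$ recursively as follows: $c_1=n$, $c_2=1$, and if $c_1,\dots,c_{2^{N+1}}$ are already defined for some integer $N\ge0$, set $$c_{2^{N+1}+i}=n-c_i\quad\text{for }1\le i\le 2^{N+1}-1,\qquad c_{2^{N+2}}=(n-c_{2^{N+1}})+1 .$$ Then $(c_i)$ is the unique expansion of the number $1$ in base $q^{(n)}$.
   Context: For a real $q>1$, an expansion of a real number $x$ in base $q$ is a sequence $(c_i)_{i\ge1}$ of integers with $0\le c_i<q$ for all $i\ge1$ and $x=\sum_{i\ge1}c_iq^{-i}$. $\mathcal U$ is the set of real numbers $q>1$ for which $1$ has exactly one expansion in base $q$. *)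

theory Defs
  imports Complex_Main
begin

(* Sequences (c_i) with i >= 1 are functions on nat whose value at 0 is irrelevant;
   accordingly, two expansions count as the same iff they agree at all i >= 1. *)

definition is_expansion :: "real \<Rightarrow> real \<Rightarrow> (nat \<Rightarrow> int) \<Rightarrow> bool" where
  "is_expansion q x c \<longleftrightarrow>
     (\<forall>i\<ge>1. 0 \<le> c i \<and> real_of_int (c i) < q) \<and>
     (\<lambda>i. real_of_int (c (Suc i)) / q ^ Suc i) sums x"

definition is_unique_expansion :: "real \<Rightarrow> real \<Rightarrow> (nat \<Rightarrow> int) \<Rightarrow> bool" where
  "is_unique_expansion q x c \<longleftrightarrow>
     is_expansion q x c \<and> (\<forall>d. is_expansion q x d \<longrightarrow> (\<forall>i\<ge>1. d i = c i))"

definition univoque_bases :: "real set" where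
  "univoque_bases = {q. q > 1 \<and> (\<exists>c. is_unique_expansion q 1 c)}"

definition univoque_between :: "nat \<Rightarrow> real set" where
  "univoque_between n = univoque_bases \<inter> {real n <..< real (n + 1)}"

definition smallest_univoque :: "nat \<Rightarrow> real" where
  "smallest_univoque n = (LEAST q. q \<in> univoque_between n)"

end

theory Submission
  imports Defs
begin

text \<open>
  For \<open>n < q < n + 1\<close> the digits are \<open>0, \<dots>, n\<close>.  Write \<open>\<sigma>\<close> for the shift and call
  \<open>i \<mapsto> n - a\<^sub>i\<close> the reflection of \<open>a\<close>.  Uniqueness of the expansion \<open>a\<close> of 1 is governed by the
  lexicographic conditions of Erdos, Joo and Komornik: for every \<open>k \<ge> 1\<close>,
  \<open>\<sigma>\<^sup>k a < a\<close> if \<open>a\<^sub>k < n\<close>, and the reflection of \<open>\<sigma>\<^sup>k a\<close> is \<open>< a\<close> if \<open>a\<^sub>k > 0\<close>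
  (\<open>lex_admissible\<close>).  The link between the two is a statement on values: \<open>a\<close> is the only digit
  sequence with its value iff, for \<open>a\<close> and for its reflection, the tail after every digit
  smaller than \<open>n\<close> has value less than 1 (\<open>univoque_iff_tails_below_one\<close>), since a tail of value
  at least 1 is precisely what permits raising the digit in front of it.  If the value of \<open>a\<close> is
  1, these tail bounds are equivalent to the lexicographic conditions
  (\<open>univoque_of_lex_admissible\<close>, \<open>lex_admissible_of_univoque\<close>).

  The theorem now follows from four facts.  The recursive sequence \<open>c\<close> is lexicographically
  admissible, which is shown for its initial blocks of length \<open>2\<^sup>N\<close> by induction on \<open>N\<close>
  (\<open>block_condition_power\<close>).  It has value 1 in some base \<open>q\<close> between \<open>n\<close> and \<open>n + 1\<close>
  (\<open>base_exists\<close>, by the intermediate value theorem), so \<open>q\<close> is univoque.  No admissible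
  sequence that starts with \<open>n\<close> is smaller than \<open>c\<close> (\<open>lex_minimal\<close>): if \<open>d\<close> first falls below \<open>c\<close>
  at a position in \<open>(2\<^sup>N, 2\<^sup>N\<^sup>+\<^sup>1]\<close>, the conditions at \<open>2\<^sup>N\<close> and \<open>2\<^sup>N\<^sup>+\<^sup>1\<close> force \<open>d\<close> to be the initial block
  of length \<open>2\<^sup>N\<close> followed by its reflection, repeated periodically, which violates the strictness
  of the conditions.  Finally, a lexicographically larger expansion of 1 belongs to a larger base
  (\<open>base_le_of_lex_le\<close>), so \<open>q\<close> is the least univoque base in the interval.
\<close>

section \<open>Digit sequences and their values\<close>

text \<open>Sequences are indexed from 1, as in \<^const>\<open>is_expansion\<close>; the entry at 0 is never constrained.\<close>

definition digits :: "nat \<Rightarrow> (nat \<Rightarrow> int) \<Rightarrow> bool" where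
  "digits n a \<longleftrightarrow> (\<forall>i\<ge>1. 0 \<le> a i \<and> a i \<le> int n)"

text \<open>The number that \<open>a\<close> represents in base \<open>q\<close>; meaningful for \<open>q > 1\<close> and bounded \<open>a\<close>.\<close>

definition val :: "real \<Rightarrow> (nat \<Rightarrow> int) \<Rightarrow> real" where
  "val q a = (\<Sum>i. real_of_int (a (Suc i)) / q ^ Suc i)"

text \<open>The tail of \<open>a\<close> after its \<open>k\<close>-th digit: \<open>shift k a\<close> has \<open>a (k + 1)\<close> as its first digit.\<close>

definition shift :: "nat \<Rightarrow> (nat \<Rightarrow> int) \<Rightarrow> nat \<Rightarrow> int" where
  "shift k a = (\<lambda>i. a (k + i))"

text \<open>Reflection exchanges greedy and lazy behaviour; on values it is
  \<open>x \<mapsto> n / (q - 1) - x\<close> (\<open>val_reflect\<close>).\<close>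

definition reflect :: "nat \<Rightarrow> (nat \<Rightarrow> int) \<Rightarrow> nat \<Rightarrow> int" where
  "reflect n a = (\<lambda>i. int n - a i)"

lemma digits_shift: "digits n a \<Longrightarrow> digits n (shift k a)"
  by (auto simp: digits_def shift_def)

lemma digits_reflect: "digits n a \<Longrightarrow> digits n (reflect n a)"
  by (auto simp: digits_def reflect_def)

lemma shift_reflect: "shift k (reflect n a) = reflect n (shift k a)"
  by (simp add: shift_def reflect_def)

lemma shift_shift: "shift j (shift k a) = shift (k + j) a"
  by (simp add: shift_def add.assoc)

lemma sums_geometric_const:
  assumes "q > 1"
  shows "(\<lambda>i. real n / q ^ Suc i) sums (real n / (q - 1))"
proof -
  have "(\<lambda>i. real n / q * (1 / q) ^ i) sums (real n / q * (1 / (1 - 1 / q)))"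
    using assms by (intro sums_mult geometric_sums) auto
  moreover have "real n / q * (1 / (1 - 1 / q)) = real n / (q - 1)"
    using assms by (simp add: field_simps)
  ultimately have "(\<lambda>i. real n / q * (1 / q) ^ i) sums (real n / (q - 1))"
    by metis
  then show ?thesis
    by (simp add: power_one_over)
qed

lemma summable_digits:
  assumes "q > 1" "digits n a"
  shows "summable (\<lambda>i. real_of_int (a (Suc i)) / q ^ Suc i)"
proof (rule summable_comparison_test'[OF sums_summable[OF sums_geometric_const[OF assms(1), of n]], of 0])
  fix i
  have "0 \<le> a (Suc i)" "a (Suc i) \<le> int n"
    using assms(2) by (auto simp: digits_def)
  then show "norm (real_of_int (a (Suc i)) / q ^ Suc i) \<le> real n / q ^ Suc i"
    using assms(1) by (auto intro!: divide_right_mono simp: of_int_le_iff abs_mult)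
qed

lemma val_sums:
  assumes "q > 1" "digits n a"
  shows "(\<lambda>i. real_of_int (a (Suc i)) / q ^ Suc i) sums val q a"
  unfolding val_def by (rule summable_sums[OF summable_digits[OF assms]])

lemma val_cong: "(\<And>i. i \<ge> 1 \<Longrightarrow> a i = b i) \<Longrightarrow> val q a = val q b"
  by (simp add: val_def)

lemma val_nonneg:
  assumes "q > 1" "digits n a"
  shows "val q a \<ge> 0"
  unfolding val_def using assms by (intro suminf_nonneg summable_digits) (auto simp: digits_def)

lemma val_pos:
  assumes "q > 1" "digits n a" "k \<ge> 1" "a k > 0"
  shows "val q a > 0"
  unfolding val_def
proof (rule suminf_pos2[OF summable_digits[OF assms(1,2)], of "k - 1"])
  show "0 \<le> real_of_int (a (Suc i)) / q ^ Suc i" for i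
    using assms(1,2) by (auto simp: digits_def)
  show "0 < real_of_int (a (Suc (k - 1))) / q ^ Suc (k - 1)"
    using assms(1,3,4) by simp
qed

lemma val_reflect:
  assumes "q > 1" "digits n a"
  shows "val q (reflect n a) = real n / (q - 1) - val q a"
proof -
  have "(\<lambda>i. real n / q ^ Suc i - real_of_int (a (Suc i)) / q ^ Suc i) sums
      (real n / (q - 1) - val q a)"
    using assms by (intro sums_diff sums_geometric_const val_sums[of q n]) auto
  then show ?thesis
    unfolding val_def reflect_def by (simp add: diff_divide_distrib sums_iff)
qed

lemma val_le:
  assumes "q > 1" "digits n a"
  shows "val q a \<le> real n / (q - 1)"
  using val_reflect[OF assms] val_nonneg[OF assms(1) digits_reflect[OF assms(2)]] by simp

lemma val_split:
  assumes "q > 1" "digits n a"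
  shows "val q a = (\<Sum>i<k. real_of_int (a (Suc i)) / q ^ Suc i) + val q (shift k a) / q ^ k"
proof -
  have "val q a = (\<Sum>i. real_of_int (a (Suc (i + k))) / q ^ Suc (i + k))
      + (\<Sum>i<k. real_of_int (a (Suc i)) / q ^ Suc i)"
    unfolding val_def by (rule suminf_split_initial_segment[OF summable_digits[OF assms]])
  moreover have "(\<Sum>i. real_of_int (a (Suc (i + k))) / q ^ Suc (i + k)) = val q (shift k a) / q ^ k"
    using suminf_divide[OF summable_digits[OF assms(1) digits_shift[OF assms(2), of k]], of "q ^ k"]
    by (simp add: val_def shift_def power_add ac_simps)
  ultimately show ?thesis by simp
qed

lemma val_diff:
  assumes q: "q > 1" and a: "digits n a" and b: "digits n b" and "j \<ge> 1"
    and eq: "\<And>i. 1 \<le> i \<Longrightarrow> i < j \<Longrightarrow> a i = b i"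
  shows "val q b - val q a =
    (real_of_int (b j - a j) + val q (shift j b) - val q (shift j a)) / q ^ j"
proof -
  obtain k where k: "j = Suc k" using \<open>j \<ge> 1\<close> by (cases j) auto
  have "(\<Sum>i<k. real_of_int (a (Suc i)) / q ^ Suc i) = (\<Sum>i<k. real_of_int (b (Suc i)) / q ^ Suc i)"
    using eq k by (intro sum.cong) auto
  then show ?thesis
    using val_split[OF q a, of j] val_split[OF q b, of j]
    by (simp add: k diff_divide_distrib add_divide_distrib)
qed

lemma val_strict_antimono:
  assumes "1 < p" "p < q" "digits n a" "a 1 > 0"
  shows "val q a < val p a"
proof -
  have le: "real_of_int (a (Suc i)) / q ^ Suc i \<le> real_of_int (a (Suc i)) / p ^ Suc i" for i
    using assms by (intro divide_left_mono power_mono mult_pos_pos) (auto simp: digits_def)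
  have "0 < (\<Sum>i. real_of_int (a (Suc i)) / p ^ Suc i - real_of_int (a (Suc i)) / q ^ Suc i)"
  proof (rule suminf_pos2[of _ 0])
    show "summable (\<lambda>i. real_of_int (a (Suc i)) / p ^ Suc i - real_of_int (a (Suc i)) / q ^ Suc i)"
      using assms by (intro summable_diff summable_digits) auto
    show "0 < real_of_int (a (Suc 0)) / p ^ Suc 0 - real_of_int (a (Suc 0)) / q ^ Suc 0"
      using assms by (simp add: divide_strict_left_mono)
  qed (use le in simp)
  also have "\<dots> = val p a - val q a"
    unfolding val_def using assms by (intro suminf_diff[symmetric] summable_digits) auto
  finally show ?thesis by simp
qed

lemma is_expansion_iff:
  assumes "n \<ge> 1" "real n < q" "q < real (n + 1)"
  shows "is_expansion q x a \<longleftrightarrow> digits n a \<and> val q a = x"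
proof -
  have "real_of_int k < q \<longleftrightarrow> k \<le> int n" for k :: int
  proof -
    have "real_of_int k < q" if "k \<le> int n"
      using that assms(2) by (smt (verit) of_int_le_iff of_int_of_nat_eq)
    moreover have "\<not> real_of_int k < q" if "\<not> k \<le> int n"
    proof -
      have "int (n + 1) \<le> k" using that by simp
      then have "real (n + 1) \<le> real_of_int k" by (metis of_int_le_iff of_int_of_nat_eq)
      then show ?thesis using assms(3) by simp
    qed
    ultimately show ?thesis by blast
  qed
  then have "is_expansion q x a \<longleftrightarrow> digits n a \<and>
      (\<lambda>i. real_of_int (a (Suc i)) / q ^ Suc i) sums x"
    by (simp add: is_expansion_def digits_def)
  also have "\<dots> \<longleftrightarrow> digits n a \<and> val q a = x"
    using val_sums[of q n a] assms(1,2) sums_unique2 by fastforce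
  finally show ?thesis .
qed

text \<open>The digits come from a greedy algorithm with remainders \<open>r\<close>.  Its digits are capped at \<open>n\<close>, so
  every remainder stays in \<open>[0, n / (q - 1)]\<close>; this is where \<open>q \<le> n + 1\<close> is needed.\<close>

lemma expansion_exists:
  assumes "q > 1" "q \<le> real (n + 1)" "0 \<le> x" "x \<le> real n / (q - 1)"
  obtains e where "digits n e" "val q e = x"
proof -
  define dig where "dig = (\<lambda>y. min (int n) \<lfloor>q * y\<rfloor>)"
  define r where "r = (\<lambda>i. ((\<lambda>y. q * y - real_of_int (dig y)) ^^ i) x)"
  define e where "e = (\<lambda>i. dig (r (i - 1)))"
  define B where "B = real n / (q - 1)"
  have r0: "r 0 = x" and rS: "r (Suc i) = q * r i - real_of_int (dig (r i))" for i
    by (simp_all add: r_def)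
  have B1: "1 \<le> B" using assms by (simp add: B_def field_simps)
  have qB: "q * B - real n = B" using assms by (simp add: B_def field_simps)
  have step: "0 \<le> dig y \<and> dig y \<le> int n \<and> 0 \<le> q * y - real_of_int (dig y)
      \<and> q * y - real_of_int (dig y) \<le> B" if y: "0 \<le> y" "y \<le> B" for y
  proof (cases "\<lfloor>q * y\<rfloor> \<le> int n")
    case True
    have "0 \<le> q * y" using y assms by simp
    then show ?thesis using True B1 by (simp add: dig_def min_def) linarith
  next
    case False
    have "q * y \<le> q * B" using y assms by simp
    moreover have "real n \<le> q * y" using False by linarith
    ultimately show ?thesis using False qB by (simp add: dig_def min_def)
  qed
  have rb: "0 \<le> r i \<and> r i \<le> B" for i
    by (induction i) (use assms step B_def in \<open>auto simp: r0 rS\<close>)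
  have e: "digits n e"
    using step rb by (auto simp: digits_def e_def)
  have part: "(\<Sum>i<k. real_of_int (e (Suc i)) / q ^ Suc i) = x - r k / q ^ k" for k
  proof (induction k)
    case (Suc k)
    have "r (Suc k) / q ^ Suc k = r k / q ^ k - real_of_int (e (Suc k)) / q ^ Suc k"
      using assms(1) by (simp add: rS e_def diff_divide_distrib)
    then show ?case using Suc by simp
  qed (simp add: r0)
  have "(\<lambda>k. B * (1 / q) ^ k) \<longlonglongrightarrow> 0"
    using assms(1) by (intro tendsto_mult_right_zero LIMSEQ_power_zero) auto
  then have "(\<lambda>k. B / q ^ k) \<longlonglongrightarrow> 0"
    by (simp add: power_one_over)
  then have "(\<lambda>k. r k / q ^ k) \<longlonglongrightarrow> 0"
    using rb assms(1)
    by (intro tendsto_sandwich[of "\<lambda>_. 0" "\<lambda>k. r k / q ^ k" _ "\<lambda>k. B / q ^ k"])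
      (auto intro!: always_eventually divide_right_mono)
  then have "(\<lambda>k. x - r k / q ^ k) \<longlonglongrightarrow> x - 0"
    by (intro tendsto_diff tendsto_const)
  then have "(\<lambda>i. real_of_int (e (Suc i)) / q ^ Suc i) sums x"
    unfolding sums_def part by simp
  then have "val q e = x" by (simp add: val_def sums_iff)
  with e show thesis by (rule that)
qed

section \<open>Lexicographic order and uniqueness\<close>

text \<open>The strict lexicographic order, comparing digits from index 1 on.\<close>

definition lexless :: "(nat \<Rightarrow> int) \<Rightarrow> (nat \<Rightarrow> int) \<Rightarrow> bool" where
  "lexless a b \<longleftrightarrow> (\<exists>j\<ge>1. a j < b j \<and> (\<forall>i. 1 \<le> i \<and> i < j \<longrightarrow> a i = b i))"

lemma lexless_cases:
  obtains "\<And>i. i \<ge> 1 \<Longrightarrow> a i = b i" | "lexless a b" | "lexless b a"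
proof (cases "\<forall>i\<ge>1. a i = b i")
  case False
  define j where "j = (LEAST i. i \<ge> 1 \<and> a i \<noteq> b i)"
  have j: "j \<ge> 1 \<and> a j \<noteq> b j"
    unfolding j_def using False by (intro LeastI_ex[of "\<lambda>i. i \<ge> 1 \<and> a i \<noteq> b i"]) auto
  have eq: "a i = b i" if "1 \<le> i" "i < j" for i
    using not_less_Least[of i "\<lambda>i. i \<ge> 1 \<and> a i \<noteq> b i"] that by (auto simp: j_def)
  consider "a j < b j" | "b j < a j" using j by linarith
  then show thesis
  proof cases
    case 1
    then have "lexless a b" unfolding lexless_def using j eq by (intro exI[of _ j]) simp
    then show thesis by (rule that(2))
  next
    case 2
    then have "lexless b a" unfolding lexless_def using j eq by (intro exI[of _ j]) simp
    then show thesis by (rule that(3))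
  qed
qed (use that in blast)

lemma lexless_asym:
  assumes "lexless a b" shows "\<not> lexless b a"
proof
  assume "lexless b a"
  then obtain k where k: "k \<ge> 1" "b k < a k" "\<And>i. 1 \<le> i \<Longrightarrow> i < k \<Longrightarrow> b i = a i"
    by (auto simp: lexless_def)
  obtain j where j: "j \<ge> 1" "a j < b j" "\<And>i. 1 \<le> i \<Longrightarrow> i < j \<Longrightarrow> a i = b i"
    using assms by (auto simp: lexless_def)
  show False
    using j(1,2) j(3)[of k] k(1,2) k(3)[of j] by (cases j k rule: linorder_cases) auto
qed

lemma lexless_reflect:
  assumes "lexless a b"
  shows "lexless (reflect n b) (reflect n a)"
proof -
  obtain j where "j \<ge> 1" "a j < b j" "\<And>i. 1 \<le> i \<Longrightarrow> i < j \<Longrightarrow> a i = b i"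
    using assms by (auto simp: lexless_def)
  then show ?thesis
    unfolding lexless_def reflect_def by (intro exI[of _ j]) simp
qed

text \<open>No digit of \<open>a\<close> that is smaller than \<open>n\<close> can be raised at the expense of the tail after it:
  the tail is worth less than one unit of that digit.\<close>

definition tails_below_one :: "real \<Rightarrow> nat \<Rightarrow> (nat \<Rightarrow> int) \<Rightarrow> bool" where
  "tails_below_one q n a \<longleftrightarrow> (\<forall>k\<ge>1. a k < int n \<longrightarrow> val q (shift k a) < 1)"

text \<open>For \<open>a\<close> with small tails, lexicographically larger sequences have larger values: raising a
  digit of \<open>a\<close> gains more than what the whole tail can lose.\<close>

lemma val_less_of_lexless:
  assumes q: "q > 1" and a: "digits n a" and b: "digits n b"
    and t: "tails_below_one q n a" and l: "lexless a b"
  shows "val q a < val q b"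
proof -
  obtain j where j: "j \<ge> 1" "a j < b j" "\<And>i. 1 \<le> i \<Longrightarrow> i < j \<Longrightarrow> a i = b i"
    using l by (auto simp: lexless_def)
  have "a j < int n" using j b by (fastforce simp: digits_def)
  then have "val q (shift j a) < 1" using t j by (simp add: tails_below_one_def)
  moreover have "val q (shift j b) \<ge> 0" by (rule val_nonneg[OF q digits_shift[OF b]])
  moreover have "real_of_int (b j - a j) \<ge> 1" using j by linarith
  ultimately have "0 < (real_of_int (b j - a j) + val q (shift j b) - val q (shift j a)) / q ^ j"
    using q by (intro divide_pos_pos) auto
  then show ?thesis using val_diff[OF q a b j(1,3)] by simp
qed

text \<open>\<open>a\<close> is the only sequence over \<open>0, \<dots>, n\<close> with its value, whatever that value is.  Unlike
  uniqueness of the expansion of 1, this notion is invariant under reflection.\<close>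

definition univoque :: "real \<Rightarrow> nat \<Rightarrow> (nat \<Rightarrow> int) \<Rightarrow> bool" where
  "univoque q n a \<longleftrightarrow> digits n a \<and>
     (\<forall>b. digits n b \<and> val q b = val q a \<longrightarrow> (\<forall>i\<ge>1. b i = a i))"

lemma univoque_reflect:
  assumes "q > 1" "univoque q n a"
  shows "univoque q n (reflect n a)"
  unfolding univoque_def
proof (intro conjI allI impI)
  have a: "digits n a" using assms(2) by (simp add: univoque_def)
  show "digits n (reflect n a)" by (rule digits_reflect[OF a])
  fix b i assume b: "digits n b \<and> val q b = val q (reflect n a)" and i: "1 \<le> (i::nat)"
  have "val q (reflect n b) = val q a"
    using b val_reflect[OF assms(1) a] val_reflect[OF assms(1), of n b] by simp
  then have "reflect n b i = a i"
    using assms(2) b i digits_reflect[of n b] unfolding univoque_def by blast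
  then show "b i = reflect n a i" by (simp add: reflect_def)
qed

lemma univoque_imp_tails_below_one:
  assumes q: "q > 1" "q \<le> real (n + 1)" and u: "univoque q n a"
  shows "tails_below_one q n a"
  unfolding tails_below_one_def
proof (intro allI impI, rule ccontr)
  fix k :: nat assume k: "1 \<le> k" "a k < int n" and "\<not> val q (shift k a) < 1"
  have a: "digits n a" using u by (simp add: univoque_def)
  have "0 \<le> val q (shift k a) - 1" "val q (shift k a) - 1 \<le> real n / (q - 1)"
    using \<open>\<not> val q (shift k a) < 1\<close> val_le[OF q(1) digits_shift[OF a], of k] by auto
  then obtain e where e: "digits n e" "val q e = val q (shift k a) - 1"
    using expansion_exists[OF q] by metis
  \<comment> \<open>Raise the \<open>k\<close>-th digit by one and compensate in the tail.\<close>
  define b where "b = (\<lambda>i. if i < k then a i else if i = k then a k + 1 else e (i - k))"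
  have b: "digits n b" using a e(1) k by (auto simp: digits_def b_def)
  have "val q (shift k b) = val q e"
    by (rule val_cong) (simp add: shift_def b_def)
  then have "val q b = val q a"
    using val_diff[OF q(1) a b k(1)] e(2) by (simp add: b_def)
  then have "b k = a k" using u b k(1) unfolding univoque_def by blast
  then show False by (simp add: b_def)
qed

lemma univoque_iff_tails_below_one:
  assumes "q > 1" "q \<le> real (n + 1)" "digits n a"
  shows "univoque q n a \<longleftrightarrow> tails_below_one q n a \<and> tails_below_one q n (reflect n a)"
proof
  assume "univoque q n a"
  then show "tails_below_one q n a \<and> tails_below_one q n (reflect n a)"
    using assms by (intro conjI univoque_imp_tails_below_one univoque_reflect)
next
  assume t: "tails_below_one q n a \<and> tails_below_one q n (reflect n a)"
  have "b i = a i" if b: "digits n b" "val q b = val q a" and i: "i \<ge> 1" for b i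
  proof (cases a b rule: lexless_cases)
    case 1
    then show ?thesis using i by simp
  next
    case 2
    then show ?thesis using val_less_of_lexless[of q n a b] t b assms by simp
  next
    case 3
    have "val q (reflect n a) < val q (reflect n b)"
      using t assms b by (intro val_less_of_lexless[of q n] lexless_reflect 3 digits_reflect) auto
    then show ?thesis
      using b val_reflect[OF assms(1,3)] val_reflect[OF assms(1) b(1)] by simp
  qed
  then show "univoque q n a" using assms(3) unfolding univoque_def by blast
qed

lemma is_unique_expansion_iff:
  assumes "n \<ge> 1" "real n < q" "q < real (n + 1)"
  shows "is_unique_expansion q x a \<longleftrightarrow> univoque q n a \<and> val q a = x"
proof (cases "val q a = x")
  case True
  show ?thesis
    unfolding is_unique_expansion_def univoque_def is_expansion_iff[OF assms] True[symmetric]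
    by blast
next
  case False
  then show ?thesis
    by (simp add: is_unique_expansion_def is_expansion_iff[OF assms])
qed

text \<open>If \<open>a\<close> and all its tails after non-maximal digits lie below the expansion \<open>c\<close> of 1, then
  \<open>a\<close> has value less than 1.  At the first difference \<open>j\<close> from \<open>c\<close>, the excess of the value over 1
  is less than \<open>q\<^sup>-\<^sup>j\<close> times the excess of the tail after \<open>j\<close>, which satisfies the same hypotheses.
  Iterating, the excess is at most a constant divided by any power of \<open>q\<close>, hence at most 0.\<close>

lemma val_less_one_of_lexless:
  assumes q: "q > 1" and c: "digits n c" "val q c = 1"
    and inf: "\<And>k. \<exists>i>k. c i > 0"
    and a: "digits n a" "lexless a c"
    and adm: "\<And>k. k \<ge> 1 \<Longrightarrow> a k < int n \<Longrightarrow> lexless (shift k a) c"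
  shows "val q a < 1"
proof -
  define P where "P = (\<lambda>a. digits n a \<and> lexless a c \<and>
    (\<forall>k\<ge>1. a k < int n \<longrightarrow> lexless (shift k a) c))"
  define B where "B = real n / (q - 1)"
  have B: "B \<ge> 0" using q by (simp add: B_def)
  have step: "\<exists>j\<ge>1. P (shift j b) \<and> val q b - 1 < (val q (shift j b) - 1) / q ^ j"
    if "P b" for b
  proof -
    have b: "digits n b" using that by (simp add: P_def)
    have "lexless b c" using that by (simp add: P_def)
    then obtain j where j: "j \<ge> 1" "b j < c j" "\<And>i. 1 \<le> i \<Longrightarrow> i < j \<Longrightarrow> b i = c i"
      by (auto simp: lexless_def)
    have bn: "b j < int n" using j c(1) by (fastforce simp: digits_def)
    have "P (shift j b)"
      using that j(1) bn by (auto simp: P_def digits_shift shift_shift) (simp add: shift_def)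
    moreover obtain i where "i > j" "c i > 0" using inf by blast
    then have "val q (shift j c) > 0"
      by (intro val_pos[OF q digits_shift[OF c(1)], of "i - j"]) (auto simp: shift_def)
    moreover have "real_of_int (c j - b j) \<ge> 1" using j by linarith
    ultimately have "P (shift j b)" and "(1 - val q (shift j b)) / q ^ j
        < (real_of_int (c j - b j) + val q (shift j c) - val q (shift j b)) / q ^ j"
      using q by (auto intro!: divide_strict_right_mono)
    moreover have "(1 - val q (shift j b)) / q ^ j = - ((val q (shift j b) - 1) / q ^ j)"
      by (simp add: diff_divide_distrib)
    ultimately show ?thesis
      using val_diff[OF q b c(1) j(1,3)] c(2) j(1) by (intro exI[of _ j]) auto
  qed
  have bound: "val q b - 1 \<le> B / q ^ m" if "P b" for b m
    using that
  proof (induction m arbitrary: b)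
    case 0
    then show ?case using val_le[OF q, of n b] by (simp add: P_def B_def)
  next
    case (Suc m)
    obtain j where j: "j \<ge> 1" "P (shift j b)" "val q b - 1 < (val q (shift j b) - 1) / q ^ j"
      using step[OF Suc.prems] by blast
    have "(val q (shift j b) - 1) / q ^ j \<le> (B / q ^ m) / q ^ j"
      using Suc.IH[OF j(2)] q by (intro divide_right_mono) auto
    also have "\<dots> \<le> (B / q ^ m) / q ^ 1"
      using B q j(1) by (intro divide_left_mono power_increasing) auto
    finally show ?case using j(3) by (simp add: field_simps)
  qed
  have le: "val q b \<le> 1" if "P b" for b
  proof -
    have "(\<lambda>m. B * (1 / q) ^ m) \<longlonglongrightarrow> 0"
      using q by (intro tendsto_mult_right_zero LIMSEQ_power_zero) auto
    then have "(\<lambda>m. B / q ^ m) \<longlonglongrightarrow> 0"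
      by (simp add: power_one_over)
    then have "val q b - 1 \<le> 0"
      by (rule LIMSEQ_le_const) (use bound[OF that] in blast)
    then show ?thesis by simp
  qed
  have "P a" using a adm by (simp add: P_def)
  then obtain j where j: "P (shift j a)" "val q a - 1 < (val q (shift j a) - 1) / q ^ j"
    using step by blast
  have "(val q (shift j a) - 1) / q ^ j \<le> 0"
    using le[OF j(1)] q by (simp add: divide_nonpos_pos)
  then show ?thesis using j(2) by simp
qed

text \<open>The lexicographic conditions that characterise unique expansions of 1.\<close>

definition lex_admissible :: "nat \<Rightarrow> (nat \<Rightarrow> int) \<Rightarrow> bool" where
  "lex_admissible n c \<longleftrightarrow> (\<forall>k\<ge>1. (c k < int n \<longrightarrow> lexless (shift k c) c) \<and>
     (0 < c k \<longrightarrow> lexless (reflect n (shift k c)) c))"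

lemma univoque_of_lex_admissible:
  assumes q: "q > 1" "q \<le> real (n + 1)" and c: "digits n c" "val q c = 1"
    and inf: "\<And>k. \<exists>i>k. c i > 0" and lex: "lex_admissible n c"
  shows "univoque q n c"
proof -
  have "tails_below_one q n c"
    unfolding tails_below_one_def
  proof (intro allI impI)
    fix k :: nat assume k: "1 \<le> k" "c k < int n"
    show "val q (shift k c) < 1"
    proof (rule val_less_one_of_lexless[OF q(1) c inf digits_shift[OF c(1)]])
      show "lexless (shift k c) c" using lex k by (simp add: lex_admissible_def)
      show "lexless (shift j (shift k c)) c" if "j \<ge> 1" "shift k c j < int n" for j
      proof -
        have "c (k + j) < int n" using that by (simp add: shift_def)
        then show ?thesis using lex that by (simp add: lex_admissible_def shift_shift)
      qed
    qed
  qed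
  moreover have "tails_below_one q n (reflect n c)"
    unfolding tails_below_one_def
  proof (intro allI impI)
    fix k :: nat assume k: "1 \<le> k" "reflect n c k < int n"
    show "val q (shift k (reflect n c)) < 1"
    proof (rule val_less_one_of_lexless[OF q(1) c inf digits_shift[OF digits_reflect[OF c(1)]]])
      show "lexless (shift k (reflect n c)) c"
      proof -
        have "0 < c k" using k by (simp add: reflect_def)
        then show ?thesis using lex k by (simp add: lex_admissible_def shift_reflect)
      qed
      show "lexless (shift j (shift k (reflect n c))) c"
        if "j \<ge> 1" "shift k (reflect n c) j < int n" for j
      proof -
        have "0 < c (k + j)" using that by (simp add: shift_def reflect_def)
        then show ?thesis
          using lex that by (simp add: lex_admissible_def shift_shift shift_reflect)
      qed
    qed
  qed
  ultimately show ?thesis using univoque_iff_tails_below_one[OF q c(1)] by simp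
qed

lemma lex_admissible_of_univoque:
  assumes q: "q > 1" "q \<le> real (n + 1)" and u: "univoque q n c" and v: "val q c = 1"
  shows "lex_admissible n c"
proof -
  have c: "digits n c" using u by (simp add: univoque_def)
  have t: "tails_below_one q n c" "tails_below_one q n (reflect n c)"
    using u univoque_iff_tails_below_one[OF q c] by auto
  have *: "lexless b c" if b: "digits n b" "val q b < 1" for b
  proof (cases b c rule: lexless_cases)
    case 1
    then show ?thesis using val_cong[of b c q] b v by simp
  next
    case 3
    then show ?thesis using val_less_of_lexless[OF q(1) c b(1) t(1)] b v by simp
  qed
  show ?thesis
    unfolding lex_admissible_def
  proof (intro allI impI conjI)
    fix k :: nat assume k: "1 \<le> k"
    show "lexless (shift k c) c" if "c k < int n"
      using * digits_shift[OF c] t(1) that k by (auto simp: tails_below_one_def)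
    show "lexless (reflect n (shift k c)) c" if "0 < c k"
    proof (rule *)
      show "digits n (reflect n (shift k c))" by (intro digits_reflect digits_shift c)
      have "reflect n c k < int n" using that by (simp add: reflect_def)
      then show "val q (reflect n (shift k c)) < 1"
        using t(2) k by (auto simp: tails_below_one_def shift_reflect)
    qed
  qed
qed

text \<open>If \<open>p < q\<close>, then \<open>d\<close> has value less than 1 in base \<open>q\<close>, whereas \<open>c \<le> d\<close> forces a value
  of at least that of \<open>c\<close>.\<close>

lemma base_le_of_lex_le:
  assumes p: "1 < p" and q: "1 < q" "q \<le> real (n + 1)"
    and d: "digits n d" "val p d = 1" "d 1 > 0"
    and c: "univoque q n c" "val q c = 1" and nl: "\<not> lexless d c"
  shows "q \<le> p"
proof (rule ccontr)
  assume "\<not> q \<le> p"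
  then have "val q d < 1" using val_strict_antimono[OF p _ d(1), of q] d by simp
  moreover have cd: "digits n c" "tails_below_one q n c"
    using c(1) q univoque_imp_tails_below_one by (auto simp: univoque_def)
  moreover have "1 \<le> val q d"
  proof (cases c d rule: lexless_cases)
    case 1
    then show ?thesis using val_cong[of c d q] c by simp
  next
    case 2
    then show ?thesis using val_less_of_lexless[OF q(1) cd(1) d(1) cd(2)] c by simp
  qed (use nl in simp)
  ultimately show False by simp
qed

section \<open>Doubling sequences\<close>

text \<open>Strict lexicographic comparison decided within the first \<open>L\<close> digits.\<close>

definition prefix_less :: "nat \<Rightarrow> (nat \<Rightarrow> int) \<Rightarrow> (nat \<Rightarrow> int) \<Rightarrow> bool" where
  "prefix_less L a b \<longleftrightarrow> (\<exists>j. 1 \<le> j \<and> j \<le> L \<and> a j < b j \<and> (\<forall>l. 1 \<le> l \<and> l < j \<longrightarrow> a l = b l))"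

lemma prefix_lessI:
  "1 \<le> j \<Longrightarrow> j \<le> L \<Longrightarrow> a j < b j \<Longrightarrow> (\<And>l. 1 \<le> l \<Longrightarrow> l < j \<Longrightarrow> a l = b l) \<Longrightarrow> prefix_less L a b"
  unfolding prefix_less_def by blast

lemma prefix_lessE:
  assumes "prefix_less L a b"
  obtains j where "1 \<le> j" "j \<le> L" "a j < b j" "\<And>l. 1 \<le> l \<Longrightarrow> l < j \<Longrightarrow> a l = b l"
  using assms unfolding prefix_less_def by blast

lemma prefix_less_mono: "prefix_less L a b \<Longrightarrow> L \<le> M \<Longrightarrow> prefix_less M a b"
  by (elim prefix_lessE, rule prefix_lessI) auto

lemma prefix_less_imp_lexless: "prefix_less L a b \<Longrightarrow> lexless a b"
  unfolding prefix_less_def lexless_def by blast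

text \<open>The recursion, in a uniform shape that also covers the step from \<open>c 1\<close> to \<open>c 2\<close>: the block of
  length \<open>2\<^sup>N\<close> is followed by its reflection with the last digit increased by one.\<close>

locale doubling_sequence =
  fixes n :: nat and c :: "nat \<Rightarrow> int"
  assumes n_pos: "n \<ge> 1"
    and first: "c 1 = int n"
    and reflected: "\<And>N i. 1 \<le> i \<Longrightarrow> i < 2 ^ N \<Longrightarrow> c (2 ^ N + i) = int n - c i"
    and doubled: "\<And>N. c (2 ^ Suc N) = int n - c (2 ^ N) + 1"
begin

lemma at_power: "1 \<le> c (2 ^ N) \<and> c (2 ^ N) \<le> int n"
proof (induction N)
  case (Suc N)
  then show ?case unfolding doubled by simp
qed (use first n_pos in simp)

lemma digits_block: "1 \<le> i \<Longrightarrow> i \<le> 2 ^ N \<Longrightarrow> 0 \<le> c i \<and> c i \<le> int n"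
proof (induction N arbitrary: i)
  case 0
  then have "i = 1" by simp
  then show ?case using first by simp
next
  case (Suc N)
  consider "i \<le> 2 ^ N" | "2 ^ N < i" "i < 2 ^ Suc N" | "i = 2 ^ Suc N"
    using Suc.prems by linarith
  then show ?case
  proof cases
    case 2
    then have "1 \<le> i - 2 ^ N" "i - 2 ^ N < 2 ^ N" "i = 2 ^ N + (i - 2 ^ N)" by auto
    then show ?thesis using reflected[of "i - 2 ^ N" N] Suc.IH[of "i - 2 ^ N"] by simp
  next
    case 3
    then show ?thesis using at_power[of "Suc N"] by simp
  qed (use Suc in simp)
qed

lemma digits: "digits n c"
  unfolding digits_def using digits_block less_exp[THEN less_imp_le] by blast

lemma infinitely_many_pos: "\<exists>i>k. c i > 0"
proof (intro exI[of _ "2 ^ k"] conjI)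
  show "0 < c (2 ^ k)" using at_power[of k] by simp
qed simp

text \<open>The lexicographic conditions for the word \<open>c 1, \<dots>, c m\<close>: its proper suffixes after digits
  below \<open>n\<close> are at most the prefix of the same length, and the reflections of its proper suffixes
  after positive digits are strictly smaller than that prefix.\<close>

definition block_condition :: "nat \<Rightarrow> bool" where
  "block_condition m \<longleftrightarrow> (\<forall>i. 1 \<le> i \<and> i < m \<longrightarrow>
     (c i < int n \<longrightarrow> prefix_less (m - i) (shift i c) c \<or>
        (\<forall>l. 1 \<le> l \<and> l \<le> m - i \<longrightarrow> c (i + l) = c l)) \<and>
     (0 < c i \<longrightarrow> prefix_less (m - i) (reflect n (shift i c)) c))"

text \<open>A suffix of the block of length \<open>2\<^sup>N\<close> that equals a prefix becomes strictly smaller once it is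
  extended into the next block.\<close>

lemma prefix_less_of_block_condition:
  assumes B: "block_condition (2 ^ N)" and i: "1 \<le> i" "i < 2 ^ N" and ci: "c i < int n"
  shows "prefix_less (2 ^ Suc N - i) (shift i c) c"
proof -
  define m :: nat where "m = 2 ^ N"
  have im: "i < m" using i by (simp add: m_def)
  have "prefix_less (m - i) (shift i c) c \<or> (\<forall>l. 1 \<le> l \<and> l \<le> m - i \<longrightarrow> c (i + l) = c l)"
    using B i ci by (simp add: block_condition_def m_def)
  then show ?thesis
  proof
    assume "prefix_less (m - i) (shift i c) c"
    then show ?thesis by (rule prefix_less_mono) (simp add: m_def)
  next
    assume eq: "\<forall>l. 1 \<le> l \<and> l \<le> m - i \<longrightarrow> c (i + l) = c l"
    \<comment> \<open>The suffix after \<open>i\<close> is also a prefix, so \<open>c (m - i)\<close> equals the last digit \<open>c m\<close>, which is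
      positive; hence the reflected condition applies at \<open>m - i\<close>.\<close>
    have "c (i + (m - i)) = c (m - i)" using eq[rule_format, of "m - i"] im by simp
    then have "0 < c (m - i)" using im at_power[of N] by (simp add: m_def)
    then have "prefix_less (m - (m - i)) (reflect n (shift (m - i) c)) c"
      using B[folded m_def, unfolded block_condition_def, rule_format, of "m - i"] im i by simp
    then obtain j where j: "1 \<le> j" "j \<le> i" "int n - c (m - i + j) < c j"
        "\<And>l. 1 \<le> l \<Longrightarrow> l < j \<Longrightarrow> int n - c (m - i + l) = c l"
      using im by (elim prefix_lessE) (simp add: reflect_def shift_def)
    have refl: "c (i + (m - i + l)) = int n - c l" if "1 \<le> l" "l \<le> j" for l
      using reflected[of l N] that j(2) im by (simp add: m_def)
    show ?thesis
    proof (rule prefix_lessI)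
      show "1 \<le> m - i + j" using j by simp
      show "m - i + j \<le> 2 ^ Suc N - i" using j im by (simp add: m_def)
      show "shift i c (m - i + j) < c (m - i + j)"
        unfolding shift_def refl[OF j(1) order.refl] using j(3) by simp
      fix l assume l: "1 \<le> l" "l < m - i + j"
      show "shift i c l = c l"
      proof (cases "l \<le> m - i")
        case True
        then show ?thesis using eq l by (simp add: shift_def)
      next
        case False
        define k where "k = l - (m - i)"
        have k: "l = m - i + k" "1 \<le> k" "k < j" using False l by (auto simp: k_def)
        then show ?thesis unfolding shift_def k(1) using refl[of k] j(4)[of k] by simp
      qed
    qed
  qed
qed

lemma block_condition_power: "block_condition (2 ^ N)"
proof (induction N)
  case 0
  then show ?case by (simp add: block_condition_def)
next
  case (Suc N)
  define m :: nat where "m = 2 ^ N"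
  have M: "2 ^ Suc N = 2 * m" by (simp add: m_def)
  have m1: "m \<ge> 1" by (simp add: m_def)
  have r: "c (m + i) = int n - c i" if "1 \<le> i" "i < m" for i
    using reflected[of i N] that by (simp add: m_def)
  have d: "c (2 * m) = int n - c m + 1" using doubled[of N] by (simp add: m_def)
  have cm: "1 \<le> c m" using at_power[of N] by (simp add: m_def)
  have IHA: "prefix_less (m - i) (shift i c) c \<or> (\<forall>l. 1 \<le> l \<and> l \<le> m - i \<longrightarrow> c (i + l) = c l)"
    if "1 \<le> i" "i < m" "c i < int n" for i
    using Suc.IH that by (simp add: block_condition_def m_def)
  have IHB: "prefix_less (m - i) (reflect n (shift i c)) c"
    if "1 \<le> i" "i < m" "0 < c i" for i
    using Suc.IH that by (simp add: block_condition_def m_def)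
  have "(c i < int n \<longrightarrow> prefix_less (2 * m - i) (shift i c) c \<or>
        (\<forall>l. 1 \<le> l \<and> l \<le> 2 * m - i \<longrightarrow> c (i + l) = c l)) \<and>
     (0 < c i \<longrightarrow> prefix_less (2 * m - i) (reflect n (shift i c)) c)"
    if i: "1 \<le> i" "i < 2 * m" for i
  proof -
    consider "i < m" | "i = m" | "m < i" by linarith
    then show ?thesis
    proof cases
      case 1
      then show ?thesis
        using prefix_less_of_block_condition[OF Suc.IH i(1)] M
          prefix_less_mono[OF IHB[OF i(1)], of "2 * m - i"] by (simp add: m_def)
    next
      case 2
      have "prefix_less m (reflect n (shift m c)) c"
      proof (rule prefix_lessI[OF m1 order.refl])
        show "reflect n (shift m c) m < c m"
          using d by (simp add: reflect_def shift_def mult_2)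
        show "reflect n (shift m c) l = c l" if "1 \<le> l" "l < m" for l
          using r[OF that] by (simp add: reflect_def shift_def)
      qed
      moreover have "prefix_less m (shift m c) c" if "c m < int n"
      proof (rule prefix_lessI[OF order.refl m1])
        have "m \<noteq> 1" using that first by auto
        then show "shift m c 1 < c 1" using r[of 1] m1 first n_pos by (simp add: shift_def)
      qed simp
      ultimately show ?thesis using 2 by simp
    next
      case 3
      define j where "j = i - m"
      have j: "1 \<le> j" "j < m" "i = m + j" "2 * m - i = m - j"
        using 3 i by (auto simp: j_def)
      have ci: "c i = int n - c j" using r j by simp
      have t: "c (i + l) = int n - c (j + l)" if "1 \<le> l" "l < m - j" for l
        using r[of "j + l"] that j by (simp add: add.assoc)
      \<comment> \<open>The suffix after \<open>i\<close> is the reflected suffix after \<open>j\<close>, with its last digit raised by one: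
        this turns \<open><\<close> for the latter into \<open>\<le>\<close>, and \<open>\<le>\<close> into \<open><\<close>.\<close>
      have t': "c (i + (m - j)) = int n - c m + 1" "j + (m - j) = m"
        using d j by (simp_all add: mult_2)
      show ?thesis
        unfolding j(4)
      proof (intro conjI impI)
        assume "c i < int n"
        then have "prefix_less (m - j) (reflect n (shift j c)) c" using IHB j ci by simp
        then obtain p where p: "1 \<le> p" "p \<le> m - j" "int n - c (j + p) < c p"
          "\<And>l. 1 \<le> l \<Longrightarrow> l < p \<Longrightarrow> int n - c (j + l) = c l"
          by (elim prefix_lessE) (simp add: reflect_def shift_def)
        have e: "c (i + l) = c l" if "1 \<le> l" "l < p" for l
          using t[of l] p that by simp
        have le: "c (i + p) \<le> c p"
        proof (cases "p = m - j")
          case True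
          then show ?thesis using t' p(3) by simp
        next
          case False
          then show ?thesis using t[of p] p by simp
        qed
        show "prefix_less (m - j) (shift i c) c \<or> (\<forall>l. 1 \<le> l \<and> l \<le> m - j \<longrightarrow> c (i + l) = c l)"
        proof (cases "c (i + p) < c p")
          case True
          then have "prefix_less (m - j) (shift i c) c"
            using p e by (intro prefix_lessI[of p]) (auto simp: shift_def)
          then show ?thesis by simp
        next
          case False
          then have eqp: "c (i + p) = c p" using le by simp
          have "p = m - j"
            using t[of p] p(1,2,3) eqp by (cases "p = m - j") auto
          then show ?thesis using e eqp by (metis le_neq_implies_less)
        qed
      next
        assume "0 < c i"
        then have "prefix_less (m - j) (shift j c) c \<or>
            (\<forall>l. 1 \<le> l \<and> l \<le> m - j \<longrightarrow> c (j + l) = c l)"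
          using IHA j ci by simp
        then show "prefix_less (m - j) (reflect n (shift i c)) c"
        proof
          assume "prefix_less (m - j) (shift j c) c"
          then obtain p where p: "1 \<le> p" "p \<le> m - j" "c (j + p) < c p"
            "\<And>l. 1 \<le> l \<Longrightarrow> l < p \<Longrightarrow> c (j + l) = c l"
            by (elim prefix_lessE) (simp add: shift_def)
          have "int n - c (i + p) \<le> c (j + p)"
            using t[of p] t' p(1,2) by (cases "p = m - j") auto
          then show ?thesis
            using p t by (intro prefix_lessI[of p]) (auto simp: reflect_def shift_def)
        next
          assume eq: "\<forall>l. 1 \<le> l \<and> l \<le> m - j \<longrightarrow> c (j + l) = c l"
          then have "c (m - j) = c m" using j t'(2) by (metis One_nat_def Suc_leI order.refl zero_less_diff)
          then show ?thesis
            using eq t t' j by (intro prefix_lessI[of "m - j"]) (auto simp: reflect_def shift_def)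
        qed
      qed
    qed
  qed
  then show ?case unfolding M block_condition_def by blast
qed

lemma lex_admissible: "lex_admissible n c"
  unfolding lex_admissible_def
proof (intro allI impI conjI)
  fix k :: nat assume k: "1 \<le> k"
  have lt: "k < 2 ^ k" by simp
  show "lexless (shift k c) c" if "c k < int n"
    by (rule prefix_less_imp_lexless[OF prefix_less_of_block_condition[OF block_condition_power k lt that]])
  show "lexless (reflect n (shift k c)) c" if "0 < c k"
    using block_condition_power[of k] k lt that
    by (intro prefix_less_imp_lexless[of "2 ^ k - k"]) (simp add: block_condition_def)
qed

lemma lex_minimal:
  assumes dg: "digits n d" and d1: "d 1 = int n" and adm: "lex_admissible n d"
  shows "\<not> lexless d c"
proof
  assume "lexless d c"
  then obtain j where j: "j \<ge> 1" "d j < c j" "\<And>i. 1 \<le> i \<Longrightarrow> i < j \<Longrightarrow> d i = c i"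
    by (auto simp: lexless_def)
  have "j \<noteq> 1" using j(2) d1 first by auto
  then have "2 \<le> j" using j(1) by simp
  then obtain N where N: "2 ^ N < j" "j \<le> 2 ^ (N + 1)"
    using ex_power_ivl2[of 2 j] by auto
  define m :: nat where "m = 2 ^ N"
  have m: "1 \<le> m" "m < j" "j \<le> 2 * m" using N by (auto simp: m_def)
  have r: "c (m + i) = int n - c i" if "1 \<le> i" "i < m" for i
    using reflected[of i N] that by (simp add: m_def)
  have c2m: "c (2 * m) = int n - c m + 1" using doubled[of N] by (simp add: m_def)
  have cm: "1 \<le> c m" using at_power[of N] by (simp add: m_def)
  have dm: "d m = c m" using j(3) m by simp
  have "lexless (reflect n (shift m d)) d"
    using adm m(1) cm dm by (simp add: lex_admissible_def)
  \<comment> \<open>Let \<open>e\<close> be the first index at which the reflected tail after \<open>m\<close> falls below \<open>d\<close>.  It lies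
    beyond \<open>m\<close>, and then the tail after \<open>2 * m\<close> first differs from \<open>d\<close> at \<open>e - m\<close>, where it is larger.\<close>
  then obtain e where e: "1 \<le> e" "int n - d (m + e) < d e"
      "\<And>i. 1 \<le> i \<Longrightarrow> i < e \<Longrightarrow> int n - d (m + i) = d i"
    by (auto simp: lexless_def reflect_def shift_def)
  have e_ge: "j - m \<le> e"
  proof (rule ccontr)
    assume "\<not> j - m \<le> e"
    then have "m + e < j" "e < m" using m by auto
    then have "int n - d (m + e) = d e" using j(3) r e(1) m by simp
    then show False using e(2) by simp
  qed
  have at: "int n - d j \<ge> c (j - m)"
  proof (cases "j = 2 * m")
    case True
    then show ?thesis using j(2) c2m by simp
  next
    case False
    then have "c j = int n - c (j - m)" using r[of "j - m"] m by simp
    then show ?thesis using j(2) by simp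
  qed
  have djm: "d (j - m) = c (j - m)" using j(3) m by simp
  have "e \<noteq> j - m" using e(2) at djm m by auto
  then have e_gt: "j - m < e" using e_ge by simp
  have eqj: "int n - d j = c (j - m)" using e(3)[of "j - m"] e_gt djm m by simp
  have jm: "j = 2 * m"
  proof (rule ccontr)
    assume "j \<noteq> 2 * m"
    then have "c j = int n - c (j - m)" using r[of "j - m"] m by simp
    then show False using j(2) eqj by simp
  qed
  have em: "m < e" using e_gt jm m(1) by simp
  have "d (2 * m) < int n" using eqj cm jm by simp
  then have "lexless (shift (2 * m) d) d"
    using adm m(1) by (simp add: lex_admissible_def)
  moreover have "lexless d (shift (2 * m) d)"
    unfolding lexless_def
  proof (intro exI[of _ "e - m"] conjI allI impI)
    show "1 \<le> e - m" using em by simp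
    have "int n - d (m + (e - m)) = d (e - m)" using e(3)[of "e - m"] em m(1) by simp
    then show "d (e - m) < shift (2 * m) d (e - m)"
      using e(2) em by (simp add: shift_def mult_2 add.assoc)
    fix i assume i: "1 \<le> i \<and> i < e - m"
    have "int n - d (m + i) = d i" "int n - d (m + (m + i)) = d (m + i)"
      using i e(3)[of i] e(3)[of "m + i"] by auto
    then show "d i = shift (2 * m) d i" by (simp add: shift_def mult_2 add.assoc)
  qed
  ultimately show False using lexless_asym by blast
qed

lemma base_exists:
  obtains q where "real n < q" "q < real (n + 1)" "val q c = 1"
proof -
  \<comment> \<open>The positive root of \<open>n / x + 1 / x\<^sup>2 = 1\<close>: the first two digits alone give value 1 in base
    \<open>x\<close>, so the required base is at least \<open>x > n\<close>.\<close>
  define x where "x = (real n + sqrt ((real n)\<^sup>2 + 4)) / 2"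
  \<comment> \<open>The value of \<open>c\<close> as a power series in \<open>y = 1 / q\<close>.\<close>
  define G where "G = (\<lambda>y. y * (\<Sum>i. real_of_int (c (Suc i)) * y ^ i))"
  have n1: "real n \<ge> 1" using n_pos by simp
  have "sqrt ((real n)\<^sup>2 + 4) > real n" by (rule real_less_rsqrt) simp
  moreover have "sqrt ((real n)\<^sup>2 + 4) < real n + 2"
    using n1 by (intro real_less_lsqrt) (auto simp: power2_eq_square algebra_simps)
  ultimately have x: "real n < x" "x < real n + 1" by (auto simp: x_def)
  have "(sqrt ((real n)\<^sup>2 + 4))\<^sup>2 = (real n)\<^sup>2 + 4" by simp
  then have xx: "x * x = real n * x + 1"
    unfolding x_def by (simp add: power2_eq_square field_simps)
  have G: "G y = val (1 / y) c" if y: "0 < y" "y < 1" for y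
  proof -
    have "(\<lambda>i. real_of_int (c (Suc i)) / (1 / y) ^ Suc i) sums val (1 / y) c"
      using y by (intro val_sums[OF _ digits]) auto
    then have "(\<lambda>i. inverse y * (real_of_int (c (Suc i)) / (1 / y) ^ Suc i)) sums
        (inverse y * val (1 / y) c)"
      by (rule sums_mult)
    then have "(\<lambda>i. real_of_int (c (Suc i)) * y ^ i) sums (inverse y * val (1 / y) c)"
      using y by (simp add: power_one_over field_simps)
    then show ?thesis using y by (simp add: G_def sums_iff)
  qed
  have cont: "isCont G y" if y: "0 < y" "y < 1" for y
  proof -
    define K where "K = (y + 1) / 2"
    have K: "y < K" "0 < K" "K < 1" using y by (auto simp: K_def)
    have "(\<lambda>i. real_of_int (c (Suc i)) / (1 / K) ^ Suc i) sums val (1 / K) c"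
      using K by (intro val_sums[OF _ digits]) auto
    then have "summable (\<lambda>i. inverse K * (real_of_int (c (Suc i)) / (1 / K) ^ Suc i))"
      by (intro summable_mult sums_summable)
    then have "summable (\<lambda>i. real_of_int (c (Suc i)) * K ^ i)"
      using K by (simp add: power_one_over field_simps)
    then have "isCont (\<lambda>y. \<Sum>i. real_of_int (c (Suc i)) * y ^ i) y"
      by (rule isCont_powser) (use K y in simp)
    then show ?thesis unfolding G_def by (intro continuous_intros)
  qed
  have c3: "c 3 = 0" using reflected[of 1 1] first by simp
  have c2: "c 2 = 1" using doubled[of 0] first by simp
  have "val (real (n + 1)) (reflect n c) > 0"
    using c3 n_pos by (intro val_pos[of _ n _ 3] digits_reflect digits) (auto simp: reflect_def)
  then have "val (real (n + 1)) c < 1"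
    using val_reflect[of "real (n + 1)" n c] digits n1 by simp
  then have lo: "G (1 / real (n + 1)) < 1" using G[of "1 / real (n + 1)"] n1 by simp
  have x1: "x > 1" using x n1 by simp
  have "val x c = real n / x + 1 / x ^ 2 + val x (shift 2 c) / x ^ 2"
    using val_split[OF x1 digits, of 2] first c2
    by (simp add: numeral_2_eq_2)
  moreover have "real n / x + 1 / x ^ 2 = 1"
  proof -
    have "real n / x + 1 / x ^ 2 = (real n * x + 1) / (x * x)"
      using x1 by (simp add: power2_eq_square add_divide_distrib)
    then show ?thesis using x1 xx[symmetric] by simp
  qed
  moreover have "val x (shift 2 c) / x ^ 2 \<ge> 0"
    using val_nonneg[OF x1 digits_shift[OF digits]] by simp
  ultimately have "val x c \<ge> 1" by simp
  then have hi: "G (1 / x) \<ge> 1" using G[of "1 / x"] x1 by simp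
  have le: "1 / real (n + 1) \<le> 1 / x" using x x1 by (intro divide_left_mono) auto
  have "\<exists>y\<ge>1 / real (n + 1). y \<le> 1 / x \<and> G y = 1"
  proof (rule IVT[OF less_imp_le[OF lo] hi le], intro allI impI cont)
    fix y assume "1 / real (n + 1) \<le> y \<and> y \<le> 1 / x"
    moreover have "0 < 1 / real (n + 1)" "1 / x < 1" using x1 by auto
    ultimately show "0 < y" "y < 1" by linarith+
  qed
  then obtain y where y: "1 / real (n + 1) \<le> y" "y \<le> 1 / x" "G y = 1" by blast
  have "0 < 1 / real (n + 1)" "1 / x < 1" using x1 by auto
  then have y01: "0 < y" "y < 1" using y by linarith+
  have "y \<noteq> 1 / real (n + 1)" using lo y(3) by auto
  then have "1 / real (n + 1) < y" using y(1) by simp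
  then have "1 / y < real (n + 1)" using y01 by (simp add: field_simps)
  moreover have "x \<le> 1 / y" using y(2) y01 x1 by (simp add: field_simps)
  ultimately show thesis
    using that[of "1 / y"] x G[OF y01] y(3) by simp
qed

end

lemma first_digit_of_univoque:
  assumes p: "real n < p" "p \<le> real (n + 1)" "1 < p"
    and u: "univoque p n d" "val p d = 1"
  shows "d 1 = int n"
proof (rule ccontr)
  have d: "digits n d" using u(1) by (simp add: univoque_def)
  assume "d 1 \<noteq> int n"
  moreover have "d 1 \<le> int n" using d by (simp add: digits_def)
  ultimately have "d 1 < int n" by simp
  then have "val p (shift 1 d) < 1" "real_of_int (d 1) \<le> real n - 1"
    using univoque_imp_tails_below_one[OF p(3,2) u(1)] by (auto simp: tails_below_one_def)
  then have "(real_of_int (d 1) + val p (shift 1 d)) / p < real n / p"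
    using p by (intro divide_strict_right_mono) auto
  then have "val p d < real n / p"
    using val_split[OF p(3) d, of 1] by (simp add: add_divide_distrib)
  moreover have "real n / p < 1" using p by simp
  ultimately show False using u(2) by simp
qed

theorem mainTheorem10:
  fixes n :: nat and c :: "nat \<Rightarrow> int"
  assumes "n \<ge> 1"
    and "c 1 = int n"
    and "c 2 = 1"
    and "\<And>N i. 1 \<le> i \<Longrightarrow> i \<le> 2 ^ (N + 1) - 1 \<Longrightarrow> c (2 ^ (N + 1) + i) = int n - c i"
    and "\<And>N. c (2 ^ (N + 2)) = (int n - c (2 ^ (N + 1))) + 1"
  shows "smallest_univoque n \<in> univoque_between n \<and>
         (\<forall>p\<in>univoque_between n. smallest_univoque n \<le> p) \<and>
         is_unique_expansion (smallest_univoque n) 1 c"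
proof -
  interpret doubling_sequence n c
  proof
    show "c (2 ^ N + i) = int n - c i" if "1 \<le> i" "i < 2 ^ N" for N i
      using assms(4)[of i "N - 1"] that by (cases N) auto
    show "c (2 ^ Suc N) = int n - c (2 ^ N) + 1" for N
      using assms(2,3) assms(5)[of "N - 1"] by (cases N) (auto simp: numeral_2_eq_2)
  qed (use assms in auto)
  obtain q where q: "real n < q" "q < real (n + 1)" "val q c = 1" by (rule base_exists)
  have q1: "1 < q" using q assms(1) by simp
  have cu: "univoque q n c"
    using q by (intro univoque_of_lex_admissible[OF q1 _ digits] infinitely_many_pos lex_admissible) auto
  have ex: "is_unique_expansion q 1 c"
    using is_unique_expansion_iff[OF assms(1) q(1,2)] cu q(3) by simp
  then have mem: "q \<in> univoque_between n"
    using q q1 by (auto simp: univoque_between_def univoque_bases_def)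
  have least: "q \<le> p" if "p \<in> univoque_between n" for p
  proof -
    have p: "real n < p" "p < real (n + 1)" and "\<exists>d. is_unique_expansion p 1 d"
      using that by (auto simp: univoque_between_def univoque_bases_def)
    then obtain d where d: "is_unique_expansion p 1 d" by blast
    have du: "univoque p n d" "val p d = 1"
      using d is_unique_expansion_iff[OF assms(1) p] by auto
    have p1: "1 < p" and pn: "p \<le> real (n + 1)" using p assms(1) by auto
    have dd: "digits n d" using du by (simp add: univoque_def)
    have d1: "d 1 = int n" by (rule first_digit_of_univoque[OF p(1) pn p1 du])
    have "\<not> lexless d c"
      by (rule lex_minimal[OF dd d1 lex_admissible_of_univoque[OF p1 pn du]])
    then show ?thesis
      using q d1 assms(1) by (intro base_le_of_lex_le[OF p1 q1 _ dd du(2) _ cu q(3)]) auto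
  qed
  have "smallest_univoque n = q"
    unfolding smallest_univoque_def by (rule Least_equality) (use mem least in auto)
  then show ?thesis using mem least ex by simp
qed

end
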